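(* Let $p,q\in\mathbb{N}$, let $\alpha_1\in(0,1)$, $\alpha_2=1-\alpha_1$, let $\mathbf{A}\in\mathbb{R}^{p\times p}$ and $\mathbf{B}\in\mathbb{R}^{q\times q}$ be symmetric positive definite, let $\mathbf{T}_1\neq\mathbf{T}_2$ be matrices in $\mathbb{R}^{p\times q}$, and let the random $p\times q$ matrix $\mathbf{X}$ satisfy $$\mathbf{X}\sim\alpha_1\mathcal{N}_{p\times q}(\mathbf{T}_1,\mathbf{A},\mathbf{B})+\alpha_2\mathcal{N}_{p\times q}(\mathbf{T}_2,\mathbf{A},\mathbf{B}).$$ Assume that $\mathbf{T}_2-\mathbf{T}_1=\mathbf{a}\mathbf{b}'$ for some $\mathbf{a}\in\mathbb{R}^p$, $\mathbf{b}\in\mathbb{R}^q$, and let $\mathbf{u}_{\mathrm{LDA}}:=\mathbf{A}^{-1}\mathbf{a}/\|\mathbf{A}^{-1}\mathbf{a}\|$ and $\mathbf{v}_{\mathrm{LDA}}:=\mathbf{B}^{-1}\mathbf{b}/\|\mathbf{B}^{-1}\mathbf{b}\|$. Let $$\kappa_{2,\mathbf{X}}(\mathbf{u},\mathbf{v}):=\mathrm{E}([\mathbf{u}'\{\mathbf{X}-\mathrm{E}(\mathbf{X})\}\mathbf{v}]^2),\qquad (\mathbf{u},\mathbf{v})\in\mathcal{U}_0:=\mathbb{S}^{p-1}\times\mathbb{S}^{q-1}.$$ Then: (i) For $(\pm\mathbf{u}_{\mathrm{LDA}},\pm\mathbf{v}_{\mathrm{LDA}})$ to be the unique maximizers of $\kappa_{2,\mathbf{X}}$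 in $\mathcal{U}_0$, it is necessary that $\mathbf{a}$ and $\mathbf{b}$ are eigenvectors of $\mathbf{A}$ and $\mathbf{B}$, respectively. (ii) Assume that $\mathbf{a}$ and $\mathbf{b}$ are eigenvectors of $\mathbf{A}$ and $\mathbf{B}$, respectively, corresponding to simple eigenvalues $\sigma_{\mathbf{a}}$ and $\lambda_{\mathbf{b}}$. Then $(\pm\mathbf{u}_{\mathrm{LDA}},\pm\mathbf{v}_{\mathrm{LDA}})$ are the unique maximizers of $\kappa_{2,\mathbf{X}}$ in $\mathcal{U}_0$ if and only if $$\sigma_{\mathbf{a}}\lambda_{\mathbf{b}}+\alpha_1\alpha_2\|\mathbf{a}\|^2\|\mathbf{b}\|^2>\sigma_1\lambda_1,$$ where $\sigma_1$ and $\lambda_1$ are the largest eigenvalues of $\mathbf{A}$ and $\mathbf{B}$, respectively.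
   Context: Prime denotes transpose, $\|\cdot\|$ is the Euclidean norm and $\mathbb{S}^{p-1}$ is the unit sphere of $\mathbb{R}^p$. $\mathcal{N}_{p\times q}(\mathbf{T},\mathbf{A},\mathbf{B})$ is the distribution of $\mathbf{T}+\mathbf{A}^{1/2}\mathbf{Z}\mathbf{B}^{1/2}$, where the entries of the $p\times q$ random matrix $\mathbf{Z}$ are i.i.d. standard normal and square roots are the symmetric positive definite ones; $\alpha_1 P_1+\alpha_2 P_2$ denotes the mixture distribution. "$(\pm\mathbf{u}_{\mathrm{LDA}},\pm\mathbf{v}_{\mathrm{LDA}})$ are the unique maximizers" means that the set of maximizers of $\kappa_{2,\mathbf{X}}$ in $\mathcal{U}_0$ is exactly $\{(s\,\mathbf{u}_{\mathrm{LDA}},t\,\mathbf{v}_{\mathrm{LDA}}):s,t\in\{-1,1\}\}$. *)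

theory Defs
  imports "HOL-Probability.Probability" "HOL-Computational_Algebra.Polynomial"
begin

(* Throughout, a matrix with rows indexed by 'p and columns indexed by 'q has type real^'q^'p. *)

definition outer_product :: "real^'p \<Rightarrow> real^'q \<Rightarrow> real^'q^'p" where
  "outer_product a b = (\<chi> i j. a $ i * b $ j)"

definition sym_pos_def :: "real^'n^'n \<Rightarrow> bool" where
  "sym_pos_def A \<longleftrightarrow> transpose A = A \<and> (\<forall>x. x \<noteq> 0 \<longrightarrow> x \<bullet> (A *v x) > 0)"

definition spd_sqrt :: "real^'n^'n \<Rightarrow> real^'n^'n" where
  "spd_sqrt A = (THE S. sym_pos_def S \<and> S ** S = A)"

definition eigenvector :: "real^'n^'n \<Rightarrow> real^'n \<Rightarrow> real \<Rightarrow> bool" where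
  "eigenvector A x k \<longleftrightarrow> x \<noteq> 0 \<and> A *v x = k *\<^sub>R x"

definition eigenvalue :: "real^'n^'n \<Rightarrow> real \<Rightarrow> bool" where
  "eigenvalue A k \<longleftrightarrow> (\<exists>x. eigenvector A x k)"

definition largest_eigenvalue :: "real^'n^'n \<Rightarrow> real" where
  "largest_eigenvalue A = (GREATEST k. eigenvalue A k)"

definition char_poly :: "real^'n^'n \<Rightarrow> real poly" where
  "char_poly A = det (\<chi> i j. (if i = j then [:0, 1:] else 0) - [:A $ i $ j:])"

definition simple_eigenvalue :: "real^'n^'n \<Rightarrow> real \<Rightarrow> bool" where
  "simple_eigenvalue A k \<longleftrightarrow> eigenvalue A k \<and> order k (char_poly A) = 1"

definition std_normal_matrix :: "(real^'q^'p) measure" where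
  "std_normal_matrix =
     distr (Pi\<^sub>M (UNIV :: ('p \<times> 'q) set) (\<lambda>_. std_normal_distribution)) borel
       (\<lambda>z. \<chi> i j. z (i, j))"

definition matrix_normal ::
    "real^'q^'p \<Rightarrow> real^'p^'p \<Rightarrow> real^'q^'q \<Rightarrow> (real^'q^'p) measure" where
  "matrix_normal T A B =
     distr std_normal_matrix borel (\<lambda>Z. T + spd_sqrt A ** Z ** spd_sqrt B)"

(* Meant for measures P and Q on the same measurable space. *)
definition mixture :: "real \<Rightarrow> 'a measure \<Rightarrow> real \<Rightarrow> 'a measure \<Rightarrow> 'a measure" where
  "mixture c P d Q =
     measure_of (space P) (sets P) (\<lambda>E. ennreal c * emeasure P E + ennreal d * emeasure Q E)"

definition kappa2 :: "'w measure \<Rightarrow> ('w \<Rightarrow> real^'q^'p) \<Rightarrow> (real^'p) \<times> (real^'q) \<Rightarrow> real" where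
  "kappa2 M X = (\<lambda>(u, v).
     prob_space.expectation M (\<lambda>\<omega>. (u \<bullet> ((X \<omega> - prob_space.expectation M X) *v v))\<^sup>2))"

definition U0 :: "((real^'p) \<times> (real^'q)) set" where
  "U0 = sphere 0 1 \<times> sphere 0 1"

definition maximizers :: "('a \<Rightarrow> real) \<Rightarrow> 'a set \<Rightarrow> 'a set" where
  "maximizers f S = {x \<in> S. \<forall>y\<in>S. f y \<le> f x}"

definition lda_direction :: "real^'n^'n \<Rightarrow> real^'n \<Rightarrow> real^'n" where
  "lda_direction A a = (1 / norm (matrix_inv A *v a)) *\<^sub>R (matrix_inv A *v a)"

definition unique_maximizers_up_to_sign ::
    "((real^'p) \<times> (real^'q) \<Rightarrow> real) \<Rightarrow> real^'p \<Rightarrow> real^'q \<Rightarrow> bool" where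
  "unique_maximizers_up_to_sign f u v \<longleftrightarrow>
     maximizers f U0 = {(s *\<^sub>R u, t *\<^sub>R v) | s t. s \<in> {-1, 1} \<and> t \<in> {-1, 1}}"

end

theory Submission
  imports Defs
begin

text \<open>
  Conditioning on the mixture component gives
  \<open>\<kappa>\<^sub>2(u, v) = (u \<bullet> A u) (v \<bullet> B v) + \<alpha>\<^sub>1 \<alpha>\<^sub>2 (a \<bullet> u)\<^sup>2 (b \<bullet> v)\<^sup>2\<close>. With \<open>v\<close> fixed this is a quadratic form in \<open>u\<close>
  with matrix \<open>c A + d a a'\<close>, so a maximizer \<open>u\<close> proportional to \<open>A\<^sup>-\<^sup>1 a\<close> is one of its eigenvectors,
  which makes \<open>a\<close> a multiple of \<open>A\<^sup>-\<^sup>1 a\<close>; likewise for \<open>b\<close>. If \<open>a\<close> and \<open>b\<close> are eigenvectors, let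
  \<open>x\<close> and \<open>y\<close> be the squared cosines of the angles between \<open>u, a\<close> and \<open>v, b\<close>. Then \<open>\<kappa>\<^sub>2\<close> is bounded by
  a function that is affine in \<open>x\<close> and in \<open>y\<close> on the unit square. Its largest vertex value is attained at
  \<open>(1, 1)\<close> (the LDA directions) or at \<open>(0, 0)\<close> (value \<open>\<sigma>\<^sub>1 \<lambda>\<^sub>1\<close>, which top eigenvectors always reach).
\<close>

section \<open>Symmetric operators and positive definite square roots\<close>

text \<open>First-order optimality: perturbing \<open>u\<close> along the residual \<open>w\<close>
  changes the homogeneous inequality \<open>x \<bullet> f x \<le> m * (x \<bullet> x)\<close> to
  first order by a multiple of \<open>w \<bullet> w\<close>, so the residual must vanish. An
  invariant subspace \<open>W\<close> is allowed so that the argument also applies on the orthogonal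
  complement of eigenvectors already found.\<close>

lemma rayleigh_maximizer_eigenvector:
  fixes f :: "'a::real_inner \<Rightarrow> 'a"
  assumes W: "subspace W" and lin: "linear f" and inv: "\<And>x. x \<in> W \<Longrightarrow> f x \<in> W"
    and sym: "\<And>x y. f x \<bullet> y = x \<bullet> f y"
    and u: "u \<in> W" "norm u = 1"
    and max: "\<And>x. x \<in> W \<Longrightarrow> norm x = 1 \<Longrightarrow> x \<bullet> f x \<le> u \<bullet> f u"
  shows "f u = (u \<bullet> f u) *\<^sub>R u"
proof -
  define m where "m = u \<bullet> f u"
  define w where "w = m *\<^sub>R u - f u"
  define Q where "Q = m * (w \<bullet> w) - w \<bullet> f w"
  have bound: "x \<bullet> f x \<le> m * (x \<bullet> x)" if "x \<in> W" for x
  proof (cases "x = 0")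
    case False
    have "x /\<^sub>R norm x \<in> W" using W that by (simp add: subspace_scale)
    from max[OF this] False have "(x \<bullet> f x) / (norm x)\<^sup>2 \<le> m"
      by (simp add: m_def linear_cmul[OF lin] power2_eq_square divide_inverse mult_ac)
    then show ?thesis using False by (simp add: pos_divide_le_eq power2_norm_eq_inner)
  qed (simp add: linear_0[OF lin])
  have wW: "w \<in> W" unfolding w_def using W u inv by (simp add: subspace_diff subspace_scale)
  have Q0: "0 \<le> Q" using bound[OF wW] by (simp add: Q_def)
  have uu: "u \<bullet> u = 1" using u by (simp add: norm_eq_1)
  have expand: "0 \<le> 2 * t * (w \<bullet> w) + t\<^sup>2 * Q" for t
  proof -
    have "u + t *\<^sub>R w \<in> W" using W u wW by (simp add: subspace_add subspace_scale)
    from bound[OF this]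
    have "0 \<le> m * (u \<bullet> u) - u \<bullet> f u + 2 * t * (m * (w \<bullet> u) - w \<bullet> f u) + t\<^sup>2 * Q"
      using sym[of u w]
      by (simp add: Q_def linear_cmul[OF lin] linear_add[OF lin] inner_simps algebra_simps power2_eq_square
          inner_commute)
    moreover have "m * (w \<bullet> u) - w \<bullet> f u = w \<bullet> w" by (simp add: w_def inner_simps)
    ultimately show ?thesis using uu by (simp add: m_def)
  qed
  have "w \<bullet> w = 0"
  proof (rule ccontr)
    assume ne: "w \<bullet> w \<noteq> 0"
    \<comment> \<open>Almost the minimizing step size of the quadratic in \<open>t\<close>; the
      added 1 keeps the denominator positive when \<open>Q = 0\<close>.\<close>
    define r where "r = (w \<bullet> w) / (Q + 1)"
    have N: "w \<bullet> w = r * (Q + 1)" using Q0 by (simp add: r_def)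
    have "0 \<le> - (r\<^sup>2 * (Q + 2))"
      using expand[of "- r"] unfolding N by (simp add: algebra_simps power2_eq_square)
    moreover have "0 < r\<^sup>2 * (Q + 2)" using ne Q0 by (simp add: r_def)
    ultimately show False by simp
  qed
  then show ?thesis by (simp add: w_def m_def)
qed

lemma rayleigh_maximizer_exists:
  fixes f :: "'a::euclidean_space \<Rightarrow> 'a"
  assumes W: "subspace W" "W \<noteq> {0}" and lin: "linear f"
  obtains u where "u \<in> W" "norm u = 1" "\<forall>x\<in>W. norm x = 1 \<longrightarrow> x \<bullet> f x \<le> u \<bullet> f u"
proof -
  have comp: "compact (W \<inter> sphere 0 1)"
    by (simp add: closed_Int_compact closed_subspace W)
  obtain y where y: "y \<in> W" "y \<noteq> 0" using W subspace_0 by blast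
  then have "y /\<^sub>R norm y \<in> W \<inter> sphere 0 1" using W by (simp add: subspace_scale)
  then have ne: "W \<inter> sphere 0 1 \<noteq> {}" by blast
  have "continuous_on (W \<inter> sphere 0 1) (\<lambda>x. x \<bullet> f x)"
    by (intro continuous_intros linear_continuous_on linear_conv_bounded_linear[THEN iffD1] lin)
  from continuous_attains_sup[OF comp ne this] that show ?thesis by auto
qed

text \<open>An orthonormal set of eigenvectors of maximal cardinality must span: otherwise its
  orthogonal complement, invariant by symmetry of \<open>f\<close>, contains a Rayleigh maximizer
  that extends the set. Eigenvalues are written as \<open>e \<bullet> f e\<close>, so no separate
  eigenvalue function is needed.\<close>

lemma orthonormal_eigenbasis:
  fixes f :: "'a::euclidean_space \<Rightarrow> 'a"
  assumes lin: "linear f" and sym: "\<And>x y. f x \<bullet> y = x \<bullet> f y"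
  obtains E where "finite E" "pairwise orthogonal E"
    "\<forall>e\<in>E. norm e = 1 \<and> f e = (e \<bullet> f e) *\<^sub>R e" "span E = UNIV"
proof -
  define P where "P E \<longleftrightarrow> pairwise orthogonal E \<and> (\<forall>e\<in>E. norm e = 1 \<and> f e = (e \<bullet> f e) *\<^sub>R e)" for E
  have ind: "independent E" if "P E" for E
    by (rule pairwise_orthogonal_independent) (use that in \<open>auto simp: P_def\<close>)
  have P0: "\<exists>E. P E \<and> card E = 0" by (rule exI[of _ "{}"]) (simp add: P_def)
  \<comment> \<open>Orthonormal sets are independent, so the dimension bounds their size and a
    greatest cardinality exists.\<close>
  have bdd: "\<forall>k. (\<exists>E. P E \<and> card E = k) \<longrightarrow> k \<le> DIM('a)"
    using ind independent_bound by blast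
  obtain E where E: "P E" and maximal: "\<And>E'. P E' \<Longrightarrow> card E' \<le> card E"
  proof -
    let ?Q = "\<lambda>k. \<exists>E. P E \<and> card E = k"
    have "?Q (Greatest ?Q)" by (rule GreatestI_nat[where P="?Q", OF P0]) (use bdd in blast)
    then obtain E where "P E" "card E = Greatest ?Q" by blast
    moreover have "card E' \<le> Greatest ?Q" if "P E'" for E'
      by (rule Greatest_le_nat[where P="?Q"]) (use bdd that in blast)+
    ultimately show ?thesis using that by simp
  qed
  have fin: "finite E" using ind[OF E] independent_bound by blast
  have "span E = UNIV"
  proof (rule ccontr)
    assume "span E \<noteq> UNIV"
    then obtain x where x: "x \<noteq> 0" "\<And>y. y \<in> span E \<Longrightarrow> orthogonal x y"
      using orthogonal_to_subspace_exists[of E] dim_eq_full[of E] dim_subset_UNIV[of E] by auto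
    define W where "W = {y. \<forall>e\<in>E. orthogonal e y}"
    have W: "subspace W" unfolding W_def by (rule subspace_orthogonal_to_vectors)
    have "x \<in> W" using x by (auto simp: W_def orthogonal_commute span_base)
    with x have W0: "W \<noteq> {0}" by auto
    have inv: "f y \<in> W" if "y \<in> W" for y
    proof -
      have "e \<bullet> f y = 0" if "e \<in> E" for e
      proof -
        have "e \<bullet> f y = f e \<bullet> y" using sym by simp
        also have "\<dots> = (e \<bullet> f e) * (e \<bullet> y)" using E that by (metis P_def inner_scaleR_left)
        finally show ?thesis using that \<open>y \<in> W\<close> by (simp add: W_def orthogonal_def)
      qed
      then show ?thesis by (simp add: W_def orthogonal_def)
    qed
    obtain u where u: "u \<in> W" "norm u = 1" "\<forall>x\<in>W. norm x = 1 \<longrightarrow> x \<bullet> f x \<le> u \<bullet> f u"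
      by (rule rayleigh_maximizer_exists[OF W W0 lin])
    have fu: "f u = (u \<bullet> f u) *\<^sub>R u"
      by (rule rayleigh_maximizer_eigenvector[OF W lin inv sym u(1,2)]) (use u(3) in auto)
    have "u \<notin> E" using u by (auto simp: W_def orthogonal_def norm_eq_1)
    moreover have "P (insert u E)" using E u fu
      by (auto simp: P_def pairwise_insert W_def orthogonal_commute)
    ultimately show False using maximal[of "insert u E"] fin by simp
  qed
  with E fin that show ?thesis by (auto simp: P_def)
qed

section \<open>Square roots of positive definite matrices\<close>

lemma sym_matrix_inner:
  fixes A :: "real^'n^'n"
  assumes "transpose A = A"
  shows "(A *v x) \<bullet> y = x \<bullet> (A *v y)"
  by (metis assms dot_lmul_matrix vector_transpose_matrix)

lemma sym_pos_def_sqrt_unique: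
  fixes S R :: "real^'n^'n"
  assumes S: "sym_pos_def S" and R: "sym_pos_def R" and eq: "S ** S = R ** R"
  shows "S = R"
proof -
  (* D = S - R satisfies S D = - D R, so an eigenvector e of D with eigenvalue k has
     k (e . S e + e . R e) = 0. *)
  have Ssym: "transpose S = S" and Rsym: "transpose R = R"
    using S R by (auto simp: sym_pos_def_def)
  define D where "D = S - R"
  have Dsym: "(D *v x) \<bullet> y = x \<bullet> (D *v y)" for x y
    using sym_matrix_inner[OF Ssym] sym_matrix_inner[OF Rsym]
    by (simp add: D_def matrix_vector_mult_diff_rdistrib inner_diff_left inner_diff_right)
  have DS: "S *v (D *v x) = - (D *v (R *v x))" for x
  proof -
    have "S *v (S *v x) = R *v (R *v x)" using eq by (simp add: matrix_vector_mul_assoc)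
    then show ?thesis by (simp add: D_def matrix_vector_mult_diff_rdistrib matrix_vector_mult_diff_distrib)
  qed
  obtain E where E: "finite E" "pairwise orthogonal E"
      "\<forall>e\<in>E. norm e = 1 \<and> D *v e = (e \<bullet> (D *v e)) *\<^sub>R e" "span E = UNIV"
    by (rule orthonormal_eigenbasis[OF matrix_vector_mul_linear[of D] Dsym])
  have "D *v e = 0" if "e \<in> E" for e
  proof -
    define k where "k = e \<bullet> (D *v e)"
    have De: "D *v e = k *\<^sub>R e" using E(3) that by (simp add: k_def)
    have e0: "e \<noteq> 0" using E(3) that by auto
    have "e \<bullet> (S *v (D *v e)) = - ((D *v e) \<bullet> (R *v e))" by (simp add: DS Dsym)
    then have "k * (e \<bullet> (S *v e) + e \<bullet> (R *v e)) = 0"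
      by (simp add: De matrix_vector_mult_scaleR algebra_simps)
    moreover have "e \<bullet> (S *v e) + e \<bullet> (R *v e) > 0"
      using S R e0 by (simp add: sym_pos_def_def add_pos_pos)
    ultimately show ?thesis by (simp add: De)
  qed
  then have "D *v x = 0" for x
    using linear_eq_0_on_span[of "(*v) D" E x] E(4) by simp
  then have "S *v x = R *v x" for x by (simp add: D_def matrix_vector_mult_diff_rdistrib)
  then show ?thesis by (simp add: matrix_eq)
qed

text \<open>Spectral calculus: in an orthonormal eigenbasis of \<open>A\<close>, take the operator
  with the same eigenvectors and the square roots of the eigenvalues.\<close>

lemma sym_pos_def_sqrt_exists:
  fixes A :: "real^'n^'n"
  assumes A: "sym_pos_def A"
  obtains S where "sym_pos_def S" "S ** S = A"
proof -
  have Asym: "transpose A = A" using A by (auto simp: sym_pos_def_def)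
  obtain E where fin: "finite E" and orth: "pairwise orthogonal E"
      and E: "\<forall>e\<in>E. norm e = 1 \<and> A *v e = (e \<bullet> (A *v e)) *\<^sub>R e" and sp: "span E = UNIV"
    by (rule orthonormal_eigenbasis[OF matrix_vector_mul_linear[of A] sym_matrix_inner[OF Asym]])
  have unit: "norm e = 1" and eig: "A *v e = (e \<bullet> (A *v e)) *\<^sub>R e" if "e \<in> E" for e
    using E that by auto
  define f where "f x = (\<Sum>e\<in>E. (sqrt (e \<bullet> (A *v e)) * (e \<bullet> x)) *\<^sub>R e)" for x
  define S where "S = matrix f"
  have lin: "linear f"
    unfolding f_def by (rule linearI) (simp_all add: inner_add_right algebra_simps sum.distrib scaleR_sum_right)
  have Sf: "S *v x = f x" for x using lin by (simp add: S_def matrix_works)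
  have pos: "e \<bullet> (A *v e) > 0" if "e \<in> E" for e
    using A unit[OF that] by (metis sym_pos_def_def norm_zero zero_neq_one)
  have inner: "e' \<bullet> e = (if e' = e then 1 else 0)" if "e \<in> E" "e' \<in> E" for e e'
    using orth unit that by (auto simp: pairwise_def orthogonal_def norm_eq_1)
  have fe: "f e = sqrt (e \<bullet> (A *v e)) *\<^sub>R e" if "e \<in> E" for e
  proof -
    have "f e = (\<Sum>e'\<in>E. if e' = e then sqrt (e \<bullet> (A *v e)) *\<^sub>R e else 0)"
      unfolding f_def using that by (intro sum.cong) (auto simp: inner)
    then show ?thesis using fin that by simp
  qed
  have "(S ** S) *v e = A *v e" if "e \<in> E" for e
    using fe[OF that] pos[OF that] eig[OF that]
    by (simp add: matrix_vector_mul_assoc[symmetric] Sf linear_cmul[OF lin])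
  then have "(S ** S) *v x = A *v x" for x
    using linear_eq_on_span[of "(*v) (S ** S)" "(*v) A" E x] sp by simp
  then have SS: "S ** S = A" by (simp add: matrix_eq)
  have "(S *v x) \<bullet> y = x \<bullet> (S *v y)" for x y
    by (simp add: Sf f_def inner_sum_left inner_sum_right inner_commute mult_ac)
  \<comment> \<open>Self-adjointness identifies the map of \<open>S\<close> with its adjoint, whose
    matrix is the transpose.\<close>
  then have tr: "transpose S = S"
    by (metis (no_types, lifting) ext adjoint_matrix adjoint_unique matrix_of_matrix_vector_mul)
  have "0 < x \<bullet> (S *v x)" if "x \<noteq> 0" for x
  proof -
    have eq: "x \<bullet> (S *v x) = (\<Sum>e\<in>E. sqrt (e \<bullet> (A *v e)) * (e \<bullet> x)\<^sup>2)"
      by (simp add: Sf f_def inner_sum_right inner_commute power2_eq_square mult_ac)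
    \<comment> \<open>A nonzero vector cannot be orthogonal to a spanning set, so at least one term
      of the nonnegative sum is strictly positive.\<close>
    have "\<exists>e\<in>E. e \<bullet> x \<noteq> 0"
    proof (rule ccontr)
      assume "\<not> ?thesis"
      have "orthogonal x y" if "y \<in> span E" for y
        by (rule orthogonal_to_span[OF that]) (use \<open>\<not> (\<exists>e\<in>E. e \<bullet> x \<noteq> 0)\<close> in \<open>auto simp: orthogonal_def inner_commute\<close>)
      then show False using sp \<open>x \<noteq> 0\<close> by (metis UNIV_I orthogonal_self)
    qed
    then obtain e where e: "e \<in> E" "e \<bullet> x \<noteq> 0" by blast
    show ?thesis unfolding eq
    proof (rule sum_pos2[OF fin e(1)])
      show "0 < sqrt (e \<bullet> (A *v e)) * (e \<bullet> x)\<^sup>2" using e pos by simp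
    next
      fix e assume "e \<in> E"
      show "0 \<le> sqrt (e \<bullet> (A *v e)) * (e \<bullet> x)\<^sup>2" using pos[OF \<open>e \<in> E\<close>] by simp
    qed
  qed
  then have "sym_pos_def S" using tr by (simp add: sym_pos_def_def)
  with SS that show ?thesis by blast
qed

text \<open>Existence and uniqueness together give the definite description in
  \<open>spd_sqrt\<close> its intended meaning.\<close>

lemma spd_sqrt:
  fixes A :: "real^'n^'n"
  assumes "sym_pos_def A"
  shows "sym_pos_def (spd_sqrt A)" "spd_sqrt A ** spd_sqrt A = A"
proof -
  obtain S where S: "sym_pos_def S" "S ** S = A" using sym_pos_def_sqrt_exists[OF assms] .
  have "spd_sqrt A = S"
    unfolding spd_sqrt_def using S sym_pos_def_sqrt_unique by (intro the_equality) auto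
  with S show "sym_pos_def (spd_sqrt A)" "spd_sqrt A ** spd_sqrt A = A" by auto
qed

text \<open>Turns the norms that arise as Gaussian variances into the quadratic forms of
  \<open>A\<close> and \<open>B\<close>.\<close>

lemma norm_spd_sqrt_mult:
  fixes A :: "real^'n^'n"
  assumes "sym_pos_def A"
  shows "(norm (spd_sqrt A *v u))\<^sup>2 = u \<bullet> (A *v u)"
proof -
  have tr: "transpose (spd_sqrt A) = spd_sqrt A"
    using spd_sqrt(1)[OF assms] by (simp add: sym_pos_def_def)
  show ?thesis
    by (simp add: power2_norm_eq_inner sym_matrix_inner[OF tr] matrix_vector_mul_assoc spd_sqrt(2)[OF assms])
qed

section \<open>Largest eigenvalues, inverses and LDA directions\<close>

text \<open>The maximum of the Rayleigh quotient on the unit sphere is itself an eigenvalue and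
  dominates all others, so \<open>GREATEST\<close> is attained and equals it.\<close>

lemma largest_eigenvalue_sym:
  fixes A :: "real^'n^'n"
  assumes A: "transpose A = A"
  shows "eigenvalue A (largest_eigenvalue A)"
    and "x \<bullet> (A *v x) \<le> largest_eigenvalue A * (norm x)\<^sup>2"
proof -
  have ne: "(UNIV :: (real^'n) set) \<noteq> {0}"
    by (metis UNIV_I singletonD zero_neq_one)
  obtain u :: "real^'n" where "u \<in> UNIV" "norm u = 1"
      and max: "\<forall>x\<in>UNIV. norm x = 1 \<longrightarrow> x \<bullet> (A *v x) \<le> u \<bullet> (A *v u)"
    by (rule rayleigh_maximizer_exists[OF subspace_UNIV ne matrix_vector_mul_linear[of A]])
  then have u: "norm u = 1" "\<And>x. norm x = 1 \<Longrightarrow> x \<bullet> (A *v x) \<le> u \<bullet> (A *v u)"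
    by auto
  have Au: "A *v u = (u \<bullet> (A *v u)) *\<^sub>R u"
    by (rule rayleigh_maximizer_eigenvector[of UNIV])
      (use u sym_matrix_inner[OF A] in auto)
  have bound: "x \<bullet> (A *v x) \<le> (u \<bullet> (A *v u)) * (norm x)\<^sup>2" for x
  proof (cases "x = 0")
    case False
    have "(x \<bullet> (A *v x)) / (norm x)\<^sup>2 \<le> u \<bullet> (A *v u)"
      using u(2)[of "x /\<^sub>R norm x"] False
      by (simp add: matrix_vector_mult_scaleR power2_eq_square divide_inverse mult_ac)
    then show ?thesis using False by (simp add: pos_divide_le_eq)
  qed simp
  have ev: "eigenvalue A (u \<bullet> (A *v u))"
    unfolding eigenvalue_def eigenvector_def using Au u by (metis norm_zero zero_neq_one)
  have "k \<le> u \<bullet> (A *v u)" if k: "eigenvalue A k" for k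
  proof -
    obtain x where x: "x \<noteq> 0" "A *v x = k *\<^sub>R x" using k by (auto simp: eigenvalue_def eigenvector_def)
    show ?thesis using bound[of x] x by (simp add: power2_norm_eq_inner)
  qed
  then have "largest_eigenvalue A = u \<bullet> (A *v u)"
    unfolding largest_eigenvalue_def using ev by (intro Greatest_equality) auto
  then show "eigenvalue A (largest_eigenvalue A)" "x \<bullet> (A *v x) \<le> largest_eigenvalue A * (norm x)\<^sup>2"
    using ev bound by auto
qed

lemma sym_pos_def_matrix_inv:
  fixes A :: "real^'n^'n"
  assumes "sym_pos_def A"
  shows "A *v (matrix_inv A *v x) = x" "matrix_inv A *v (A *v x) = x"
proof -
  have "x = 0" if "A *v x = 0" for x
    using assms that by (metis inner_zero_right less_irrefl sym_pos_def_def)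
  then have "\<exists>B. B ** A = mat 1" using matrix_left_invertible_ker by blast
  then have inv: "invertible A" by (simp add: invertible_left_inverse)
  show "A *v (matrix_inv A *v x) = x" "matrix_inv A *v (A *v x) = x"
    \<comment> \<open>\<open>matrix_inv\<close> is a choice among two-sided inverses, so its
      properties come from the existence of one.\<close>
    using someI_ex[of "\<lambda>A'. A ** A' = mat 1 \<and> A' ** A = mat 1"] inv
    by (auto simp: invertible_def matrix_inv_def matrix_vector_mul_assoc)
qed

lemma eigenvalue_unit_eigenvector:
  assumes "eigenvalue A k"
  obtains x where "norm x = 1" "A *v x = k *\<^sub>R x"
proof -
  obtain x where x: "x \<noteq> 0" "A *v x = k *\<^sub>R x" using assms by (auto simp: eigenvalue_def eigenvector_def)
  show ?thesis
    by (rule that[of "(1 / norm x) *\<^sub>R x"]) (use x in \<open>simp_all add: matrix_vector_mult_scaleR\<close>)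
qed

lemma eigenvalue_sym_pos_def:
  assumes "sym_pos_def A" "eigenvalue A k"
  shows "0 < k"
proof -
  obtain x where x: "x \<noteq> 0" "A *v x = k *\<^sub>R x" using assms(2) by (auto simp: eigenvalue_def eigenvector_def)
  then have "0 < k * (x \<bullet> x)" using assms(1) by (metis inner_scaleR_right sym_pos_def_def)
  then show ?thesis by (rule zero_less_mult_pos2) (use x in simp)
qed

text \<open>On an eigenvector the inverse acts as division by \<open>k\<close>. Since
  \<open>k\<close> is positive, normalizing removes it without flipping the sign.\<close>

lemma lda_direction_eigenvector:
  assumes A: "sym_pos_def A" and a: "eigenvector A a k"
  shows "lda_direction A a = (1 / norm a) *\<^sub>R a"
proof -
  have k: "0 < k" using eigenvalue_sym_pos_def[OF A] a by (auto simp: eigenvalue_def)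
  have "a = matrix_inv A *v (k *\<^sub>R a)"
    using a sym_pos_def_matrix_inv(2)[OF A, of a] by (simp add: eigenvector_def)
  then have "(1 / k) *\<^sub>R a = (1 / k) *\<^sub>R (matrix_inv A *v (k *\<^sub>R a))" by simp
  then have "matrix_inv A *v a = (1 / k) *\<^sub>R a"
    using k by (simp add: matrix_vector_mult_scaleR)
  then show ?thesis using k by (simp add: lda_direction_def)
qed

section \<open>Second moments under mixtures of matrix normal distributions\<close>

lemma sets_mixture [simp]: "sets (mixture c P d Q) = sets P"
  and space_mixture [simp]: "space (mixture c P d Q) = space P"
  by (simp_all add: mixture_def)

lemma emeasure_mixture:
  assumes sets: "sets P = sets Q" and E: "E \<in> sets P"
  shows "emeasure (mixture c P d Q) E = ennreal c * emeasure P E + ennreal d * emeasure Q E"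
proof (rule emeasure_measure_of[OF mixture_def])
  show "sets P \<subseteq> Pow (space P)" by (rule sets.space_closed)
  show "positive (sets (mixture c P d Q)) (\<lambda>E. ennreal c * emeasure P E + ennreal d * emeasure Q E)"
    by (simp add: positive_def)
  show "countably_additive (sets (mixture c P d Q))
     (\<lambda>E. ennreal c * emeasure P E + ennreal d * emeasure Q E)"
  proof (rule countably_additiveI)
    fix F :: "nat \<Rightarrow> 'a set"
    assume F: "range F \<subseteq> sets (mixture c P d Q)" "disjoint_family F"
    have P: "(\<Sum>i. emeasure P (F i)) = emeasure P (\<Union>i. F i)"
      using F by (intro suminf_emeasure) auto
    have Q: "(\<Sum>i. emeasure Q (F i)) = emeasure Q (\<Union>i. F i)"
      using F sets by (intro suminf_emeasure) auto
    show "(\<Sum>i. ennreal c * emeasure P (F i) + ennreal d * emeasure Q (F i)) =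
      ennreal c * emeasure P (\<Union>i. F i) + ennreal d * emeasure Q (\<Union>i. F i)"
      by (simp add: suminf_add[symmetric] P Q)
  qed
qed (use E in simp)

text \<open>Induction on measurable functions: the identity holds for indicators, and both sides
  respect scaling, sums and increasing limits.\<close>

lemma nn_integral_mixture:
  assumes sets: "sets P = sets Q" and f: "f \<in> borel_measurable P"
  shows "(\<integral>\<^sup>+x. f x \<partial>mixture c P d Q) = ennreal c * (\<integral>\<^sup>+x. f x \<partial>P) + ennreal d * (\<integral>\<^sup>+x. f x \<partial>Q)"
proof -
  have mQ: "g \<in> borel_measurable Q" "g \<in> borel_measurable (mixture c P d Q)"
    if "g \<in> borel_measurable P" for g :: "'a \<Rightarrow> ennreal"
    using that by (simp_all cong: measurable_cong_sets add: sets)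
  have sp: "space Q = space P" using sets_eq_imp_space_eq[OF sets] by simp
  from f show ?thesis
  proof (induction rule: borel_measurable_induct)
    case (cong f g)
    have "integral\<^sup>N N f = integral\<^sup>N N g" if "space N = space P" for N :: "'a measure"
      by (rule nn_integral_cong) (use cong(3) that in auto)
    from this[of P] this[of Q] this[of "mixture c P d Q"] cong(4) sp show ?case by simp
  next
    case (set E)
    then show ?case by (simp add: emeasure_mixture[OF sets] sets[symmetric])
  next
    case (mult g a)
    show ?case
      using mult.IH by (simp add: nn_integral_cmult mQ mult.hyps distrib_left mult_ac)
  next
    case (add g h)
    show ?case
      using add.IH by (simp add: nn_integral_add mQ add.hyps distrib_left add_ac)
  next
    case (seq U)
    have U: "U i \<in> borel_measurable P" "U i \<in> borel_measurable Q"
      "U i \<in> borel_measurable (mixture c P d Q)" for i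
      by (rule seq(1), rule mQ(1)[OF seq(1)], rule mQ(2)[OF seq(1)])
    have SUP: "integral\<^sup>N N (SUP i. U i) = (SUP i. integral\<^sup>N N (U i))"
      if "\<And>i. U i \<in> borel_measurable N" for N :: "'a measure"
      unfolding nn_integral_monotone_convergence_SUP[OF \<open>incseq U\<close> that, symmetric]
      by (simp add: SUP_apply[abs_def])
    have inc: "integral\<^sup>N N (U i) \<le> integral\<^sup>N N (U j)" if "i \<le> j" for i j and N :: "'a measure"
      by (rule nn_integral_mono) (use \<open>incseq U\<close> that in \<open>simp add: incseqD le_funD\<close>)
    \<comment> \<open>Monotonicity is what allows the sum of two suprema to be taken as one supremum
      of sums.\<close>
    have inc': "incseq (\<lambda>i. ennreal e * integral\<^sup>N N (U i))" for e and N :: "'a measure"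
      by (rule monoI) (simp add: mult_left_mono inc)
    show ?case
      unfolding SUP[OF U(1)] SUP[OF U(2)] SUP[OF U(3)] seq.IH ennreal_SUP_add[OF inc' inc'] SUP_mult_left_ennreal ..
  qed
qed

text \<open>Apply the nonnegative case to the positive and negative parts of \<open>f\<close>
  separately and subtract.\<close>

lemma mixture_integral:
  fixes f :: "'a \<Rightarrow> real"
  assumes sets: "sets P = sets Q" and c: "0 \<le> c" "0 \<le> d"
    and P: "integrable P f" and Q: "integrable Q f"
  shows integrable_mixture: "integrable (mixture c P d Q) f"
    and integral_mixture: "(\<integral>x. f x \<partial>mixture c P d Q) = c * (\<integral>x. f x \<partial>P) + d * (\<integral>x. f x \<partial>Q)"
proof -
  have f: "f \<in> borel_measurable P" using P by auto
  have fm: "f \<in> borel_measurable (mixture c P d Q)"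
    using f by (simp cong: measurable_cong_sets)
  have nn: "(\<integral>\<^sup>+x. ennreal (g x) \<partial>mixture c P d Q) =
      ennreal c * (\<integral>\<^sup>+x. ennreal (g x) \<partial>P) + ennreal d * (\<integral>\<^sup>+x. ennreal (g x) \<partial>Q)"
    if "g \<in> borel_measurable P" for g :: "'a \<Rightarrow> real"
    by (rule nn_integral_mixture[OF sets]) (use that in measurable)
  have fin: "(\<integral>\<^sup>+x. ennreal (f x) \<partial>P) \<noteq> \<infinity>" "(\<integral>\<^sup>+x. ennreal (- f x) \<partial>P) \<noteq> \<infinity>"
    "(\<integral>\<^sup>+x. ennreal (f x) \<partial>Q) \<noteq> \<infinity>" "(\<integral>\<^sup>+x. ennreal (- f x) \<partial>Q) \<noteq> \<infinity>"
    using P Q by (auto simp: real_integrable_def)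
  \<comment> \<open>\<open>enn2real\<close> sends infinity to 0, so it is additive only on finite
    values; integrability under \<open>P\<close> and \<open>Q\<close> supplies finiteness.\<close>
  have lin: "enn2real (ennreal c * x + ennreal d * y) = c * enn2real x + d * enn2real y"
    if "x \<noteq> \<top>" "y \<noteq> \<top>" for x y
    using that c by (cases x; cases y) (simp_all add: ennreal_mult[symmetric] ennreal_plus[symmetric] del: ennreal_plus)
  show int: "integrable (mixture c P d Q) f"
    unfolding real_integrable_def using fm fin f
    by (simp add: nn ennreal_mult_eq_top_iff)
  show "(\<integral>x. f x \<partial>mixture c P d Q) = c * (\<integral>x. f x \<partial>P) + d * (\<integral>x. f x \<partial>Q)"
    unfolding real_lebesgue_integral_def[OF int] real_lebesgue_integral_def[OF P] real_lebesgue_integral_def[OF Q]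
    using fin f by (simp add: nn lin algebra_simps)
qed

section \<open>Moments of standard normal vectors\<close>

lemma std_normal_distribution_moments:
  shows "integrable std_normal_distribution (\<lambda>x. x)" "(\<integral>x. x \<partial>std_normal_distribution) = 0"
    and "integrable std_normal_distribution (\<lambda>x. x * x)" "(\<integral>x. x * x \<partial>std_normal_distribution) = 1"
proof -
  have 1: "has_bochner_integral std_normal_distribution (\<lambda>x. x) 0"
    by (rule has_bochner_integral_density) (use std_normal_moment_odd[of 0] in auto)
  have 2: "has_bochner_integral std_normal_distribution (\<lambda>x. x * x) 1"
    by (rule has_bochner_integral_density) (use std_normal_moment_even[of 1] in \<open>auto simp: power2_eq_square\<close>)
  show "integrable std_normal_distribution (\<lambda>x. x)" "(\<integral>x. x \<partial>std_normal_distribution) = 0"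
    "integrable std_normal_distribution (\<lambda>x. x * x)" "(\<integral>x. x * x \<partial>std_normal_distribution) = 1"
    using 1 2 by (auto simp: has_bochner_integral_iff)
qed

abbreviation std_normal_vector :: "('i \<Rightarrow> real) measure" where
  "std_normal_vector \<equiv> Pi\<^sub>M UNIV (\<lambda>_. std_normal_distribution)"

lemma prob_space_std_normal_vector: "prob_space std_normal_vector"
  by (intro prob_space_PiM prob_space_normal_density) simp

text \<open>Each monomial is a product over all coordinates of one-variable factors, so its integral
  under the product measure is the product of one-dimensional integrals.\<close>

lemma std_normal_vector_moments:
  fixes i j :: "'i::finite"
  shows "integrable std_normal_vector (\<lambda>z. z i)" "(\<integral>z. z i \<partial>std_normal_vector) = 0"
    and "integrable std_normal_vector (\<lambda>z. z i * z j)"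
      "(\<integral>z. z i * z j \<partial>std_normal_vector) = (if i = j then 1 else 0)"
proof -
  interpret N: prob_space std_normal_distribution by (rule prob_space_normal_density) simp
  interpret product_sigma_finite "\<lambda>_::'i. std_normal_distribution" by standard
  \<comment> \<open>Evaluates the integrals of the constant factors 1.\<close>
  have "N.prob UNIV = 1" using N.prob_space by simp
  note [simp] = std_normal_distribution_moments this
  define f :: "'i \<Rightarrow> real \<Rightarrow> real" where "f k x = (if k = i then x else 1)" for k x
  have f: "integrable std_normal_distribution (f k)" for k by (cases "k = i") (simp_all add: f_def[abs_def])
  have zi: "(\<lambda>z. z i) = (\<lambda>z. \<Prod>k\<in>UNIV. f k (z k))" by (simp add: f_def)
  show "integrable std_normal_vector (\<lambda>z. z i)"
    unfolding zi by (rule product_integrable_prod) (auto intro: f)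
  show "(\<integral>z. z i \<partial>std_normal_vector) = 0"
  proof -
    have "integral\<^sup>L std_normal_distribution (f i) = 0" by (simp add: f_def[abs_def])
    then have "(\<Prod>k\<in>UNIV. integral\<^sup>L std_normal_distribution (f k)) = 0" by (auto intro!: prod_zero)
    then show ?thesis unfolding zi by (subst product_integral_prod) (simp_all add: f)
  qed
  \<comment> \<open>Two conditional factors handle both cases at once: for \<open>i = j\<close> the
    factor at \<open>i\<close> is a square, otherwise two different coordinates each contribute a
    mean 0.\<close>
  define g :: "'i \<Rightarrow> real \<Rightarrow> real"
    where "g k x = (if k = i then x else 1) * (if k = j then x else 1)" for k x
  have g: "integrable std_normal_distribution (g k)" for k
    by (cases "k = i"; cases "k = j") (simp_all add: g_def[abs_def])
  have zij: "(\<lambda>z. z i * z j) = (\<lambda>z. \<Prod>k\<in>UNIV. g k (z k))" by (simp add: g_def prod.distrib)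
  show "integrable std_normal_vector (\<lambda>z. z i * z j)"
    unfolding zij by (rule product_integrable_prod) (auto intro: g)
  have "(\<integral>z. z i * z j \<partial>std_normal_vector) = (\<Prod>k\<in>UNIV. integral\<^sup>L std_normal_distribution (g k))"
    unfolding zij by (rule product_integral_prod) (auto intro: g)
  also have "\<dots> = (if i = j then 1 else 0)"
  proof (cases "i = j")
    case True
    have "integral\<^sup>L std_normal_distribution (g k) = 1" for k
      using True by (cases "k = i") (simp_all add: g_def[abs_def])
    then show ?thesis using True by simp
  next
    case False
    then have "integral\<^sup>L std_normal_distribution (g i) = 0" by (simp add: g_def[abs_def])
    then show ?thesis using False by (auto intro!: prod_zero)
  qed
  finally show "(\<integral>z. z i * z j \<partial>std_normal_vector) = (if i = j then 1 else 0)" .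
qed

text \<open>In the expanded square the linear term has mean 0 and, in the double sum, only the
  diagonal survives.\<close>

lemma std_normal_vector_affine:
  fixes c :: "'i::finite \<Rightarrow> real"
  shows "integrable std_normal_vector (\<lambda>z. m + (\<Sum>i\<in>UNIV. c i * z i))"
    and "(\<integral>z. m + (\<Sum>i\<in>UNIV. c i * z i) \<partial>std_normal_vector) = m"
    and "integrable std_normal_vector (\<lambda>z. (m + (\<Sum>i\<in>UNIV. c i * z i))\<^sup>2)"
    and "(\<integral>z. (m + (\<Sum>i\<in>UNIV. c i * z i))\<^sup>2 \<partial>std_normal_vector) = m\<^sup>2 + (\<Sum>i\<in>UNIV. (c i)\<^sup>2)"
proof -
  interpret prob_space "std_normal_vector :: ('i \<Rightarrow> real) measure" by (rule prob_space_std_normal_vector)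
  note [simp] = std_normal_vector_moments prob_space
  let ?S = "\<lambda>z. \<Sum>i\<in>UNIV. c i * z i"
  let ?D = "\<lambda>z. \<Sum>i\<in>UNIV. \<Sum>j\<in>UNIV. (c i * c j) * (z i * z j)"
  have S: "integrable std_normal_vector ?S" "(\<integral>z. ?S z \<partial>std_normal_vector) = 0" by simp_all
  have D: "integrable std_normal_vector ?D" by simp
  have "(\<integral>z. ?D z \<partial>std_normal_vector) = (\<Sum>i\<in>UNIV. \<Sum>j\<in>UNIV. (c i * c j) * (if i = j then 1 else 0))"
    by simp
  also have "\<dots> = (\<Sum>i\<in>UNIV. (c i)\<^sup>2)" by (simp add: if_distrib[of "\<lambda>x. _ * x"] power2_eq_square cong: if_cong)
  finally have D': "(\<integral>z. ?D z \<partial>std_normal_vector) = (\<Sum>i\<in>UNIV. (c i)\<^sup>2)" .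
  show "integrable std_normal_vector (\<lambda>z. m + ?S z)" "(\<integral>z. m + ?S z \<partial>std_normal_vector) = m"
    using S by simp_all
  have sq: "(\<lambda>z. (m + ?S z)\<^sup>2) = (\<lambda>z. (m\<^sup>2 + 2 * m * ?S z) + ?D z)"
    by (rule ext) (simp add: power2_eq_square algebra_simps sum_product)
  have L: "integrable std_normal_vector (\<lambda>z. m\<^sup>2 + 2 * m * ?S z)"
    using S by (intro Bochner_Integration.integrable_add integrable_mult_right) simp_all
  have L': "(\<integral>z. m\<^sup>2 + 2 * m * ?S z \<partial>std_normal_vector) = m\<^sup>2"
    using S by (subst Bochner_Integration.integral_add) simp_all
  show "integrable std_normal_vector (\<lambda>z. (m + ?S z)\<^sup>2)"
    unfolding sq using L D by (rule Bochner_Integration.integrable_add)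
  show "(\<integral>z. (m + ?S z)\<^sup>2 \<partial>std_normal_vector) = m\<^sup>2 + (\<Sum>i\<in>UNIV. (c i)\<^sup>2)"
    unfolding sq by (subst Bochner_Integration.integral_add[OF L D]) (simp only: L' D')
qed

section \<open>Bilinear forms of matrix normal variables\<close>

lemma measurable_matrix_of_entries [measurable]:
  "(\<lambda>z. \<chi> i j. z (i, j)) \<in> (std_normal_vector :: ('p::finite \<times> 'q::finite \<Rightarrow> real) measure) \<rightarrow>\<^sub>M
     (borel :: (real^'q^'p) measure)"
  (is "?f \<in> _")
proof (rule borel_measurable_euclidean_space[THEN iffD2], intro ballI)
  fix e :: "real^'q^'p"
  assume "e \<in> Basis"
  have "(\<lambda>z. z k) \<in> borel_measurable (std_normal_vector :: ('p \<times> 'q \<Rightarrow> real) measure)" for k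
    using measurable_component_singleton[of k UNIV "\<lambda>_. std_normal_distribution"] by simp
  then show "(\<lambda>z. ?f z \<bullet> e) \<in> borel_measurable std_normal_vector"
    unfolding inner_vec_def by (simp add: borel_measurable_sum borel_measurable_times)
qed

lemma measurable_two_sided_mult:
  fixes S :: "real^'p^'p" and R :: "real^'q^'q"
  shows "(\<lambda>Z. T + S ** Z ** R) \<in> borel_measurable borel"
proof (rule borel_measurable_continuous_onI)
  show "continuous_on UNIV (\<lambda>Z. T + S ** Z ** R)"
    unfolding matrix_matrix_mult_def by (intro continuous_intros)
qed

lemma measurable_bilinear_form [measurable]:
  fixes u :: "real^'p" and v :: "real^'q"
  shows "(\<lambda>Y. u \<bullet> (Y *v v)) \<in> borel_measurable borel"
proof (rule borel_measurable_continuous_onI)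
  show "continuous_on UNIV (\<lambda>Y. u \<bullet> (Y *v v))"
    unfolding matrix_vector_mult_def by (intro continuous_intros)
qed

text \<open>Treating the pair of row and column as a single index makes the form a linear
  combination of independent standard normals.\<close>

lemma bilinear_form_eq_sum:
  fixes u :: "real^'p" and v :: "real^'q" and z :: "'p \<times> 'q \<Rightarrow> real"
  shows "u \<bullet> ((\<chi> i j. z (i, j)) *v v) = (\<Sum>k\<in>UNIV. (u $ fst k * v $ snd k) * z k)"
  by (simp add: inner_vec_def matrix_vector_mult_def sum_distrib_left sum.cartesian_product
      UNIV_Times_UNIV[symmetric] case_prod_beta mult_ac del: UNIV_Times_UNIV)

lemma sum_squares_outer_product:
  fixes u :: "real^'p" and v :: "real^'q"
  shows "(\<Sum>k\<in>UNIV. (u $ fst k * v $ snd k)\<^sup>2) = (norm u)\<^sup>2 * (norm v)\<^sup>2"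
proof -
  have "(\<Sum>k\<in>UNIV. (u $ fst k * v $ snd k)\<^sup>2) = (\<Sum>k\<in>UNIV \<times> UNIV. (u $ fst k)\<^sup>2 * (v $ snd k)\<^sup>2)"
    by (simp add: power_mult_distrib)
  also have "\<dots> = (\<Sum>i\<in>UNIV. (u $ i)\<^sup>2) * (\<Sum>j\<in>UNIV. (v $ j)\<^sup>2)"
    unfolding sum_product sum.cartesian_product by (simp add: case_prod_beta)
  also have "\<dots> = (norm u)\<^sup>2 * (norm v)\<^sup>2"
    unfolding power2_norm_eq_inner by (simp add: inner_vec_def power2_eq_square)
  finally show ?thesis .
qed

text \<open>Moving the symmetric root of \<open>A\<close> onto \<open>u\<close> shows the form to be
  affine in the Gaussian entries. The centre \<open>m\<close> is left free because the mixture mean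
  generally differs from the mean of each component.\<close>

lemma matrix_normal_bilinear_form:
  fixes u :: "real^'p" and v :: "real^'q"
  assumes A: "sym_pos_def A" and B: "sym_pos_def B"
  shows "integrable (matrix_normal T A B) (\<lambda>Y. u \<bullet> (Y *v v))"
    and "(\<integral>Y. u \<bullet> (Y *v v) \<partial>matrix_normal T A B) = u \<bullet> (T *v v)"
    and "integrable (matrix_normal T A B) (\<lambda>Y. (u \<bullet> (Y *v v) - m)\<^sup>2)"
    and "(\<integral>Y. (u \<bullet> (Y *v v) - m)\<^sup>2 \<partial>matrix_normal T A B) =
      (u \<bullet> (T *v v) - m)\<^sup>2 + (u \<bullet> (A *v u)) * (v \<bullet> (B *v v))"
proof -
  define S R where "S = spd_sqrt A" and "R = spd_sqrt B"
  have trS: "transpose S = S" using spd_sqrt(1)[OF A] by (simp add: sym_pos_def_def S_def)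
  define c where "c k = (S *v u) $ fst k * (R *v v) $ snd k" for k
  define g :: "('p \<times> 'q \<Rightarrow> real) \<Rightarrow> real^'q^'p"
    where "g z = T + S ** (\<chi> i j. z (i, j)) ** R" for z
  have N: "matrix_normal T A B = distr std_normal_vector borel g"
    unfolding matrix_normal_def std_normal_matrix_def g_def S_def R_def
    by (subst distr_distr[OF measurable_two_sided_mult measurable_matrix_of_entries]) (simp add: comp_def)
  have g: "g \<in> std_normal_vector \<rightarrow>\<^sub>M borel"
    unfolding g_def by (rule measurable_compose[OF measurable_matrix_of_entries measurable_two_sided_mult])
  have form: "u \<bullet> (g z *v v) = u \<bullet> (T *v v) + (\<Sum>k\<in>UNIV. c k * z k)" for z
  proof -
    have "u \<bullet> (g z *v v) = u \<bullet> (T *v v) + u \<bullet> (S *v ((\<chi> i j. z (i, j)) *v (R *v v)))"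
      by (simp add: g_def matrix_vector_mult_add_rdistrib inner_add_right matrix_vector_mul_assoc matrix_mul_assoc)
    also have "u \<bullet> (S *v ((\<chi> i j. z (i, j)) *v (R *v v))) = (S *v u) \<bullet> ((\<chi> i j. z (i, j)) *v (R *v v))"
      by (rule sym_matrix_inner[OF trS, symmetric])
    also have "\<dots> = (\<Sum>k\<in>UNIV. c k * z k)" unfolding c_def by (rule bilinear_form_eq_sum)
    finally show ?thesis .
  qed
  have form': "u \<bullet> (g z *v v) - m = (u \<bullet> (T *v v) - m) + (\<Sum>k\<in>UNIV. c k * z k)" for z
    by (simp add: form)
  have c: "(\<Sum>k\<in>UNIV. (c k)\<^sup>2) = (u \<bullet> (A *v u)) * (v \<bullet> (B *v v))"
    unfolding c_def sum_squares_outer_product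
    by (simp add: S_def R_def norm_spd_sqrt_mult[OF A] norm_spd_sqrt_mult[OF B])
  have m2: "(\<lambda>Y. (u \<bullet> (Y *v v) - m)\<^sup>2) \<in> borel_measurable borel" by measurable
  show "integrable (matrix_normal T A B) (\<lambda>Y. u \<bullet> (Y *v v))"
    unfolding N integrable_distr_eq[OF g measurable_bilinear_form] form by (rule std_normal_vector_affine)
  show "(\<integral>Y. u \<bullet> (Y *v v) \<partial>matrix_normal T A B) = u \<bullet> (T *v v)"
    unfolding N integral_distr[OF g measurable_bilinear_form] form by (rule std_normal_vector_affine)
  show "integrable (matrix_normal T A B) (\<lambda>Y. (u \<bullet> (Y *v v) - m)\<^sup>2)"
    unfolding N integrable_distr_eq[OF g m2] form' by (rule std_normal_vector_affine)
  show "(\<integral>Y. (u \<bullet> (Y *v v) - m)\<^sup>2 \<partial>matrix_normal T A B) =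
      (u \<bullet> (T *v v) - m)\<^sup>2 + (u \<bullet> (A *v u)) * (v \<bullet> (B *v v))"
    unfolding N integral_distr[OF g m2] form' c[symmetric] by (rule std_normal_vector_affine)
qed

section \<open>Second moment of the projected mixture\<close>

lemma integrable_matrixI:
  fixes X :: "'w \<Rightarrow> real^'q^'p"
  assumes "\<And>i j. integrable M (\<lambda>\<omega>. X \<omega> $ i $ j)"
  shows "integrable M X"
proof -
  have "integrable M (\<lambda>\<omega>. \<Sum>e\<in>Basis. (X \<omega> \<bullet> e) *\<^sub>R e)"
    unfolding inner_vec_def using assms
    by (intro Bochner_Integration.integrable_sum integrable_scaleR_left) simp
  then show ?thesis by (simp add: euclidean_representation)
qed

text \<open>All expectations depend only on the law of \<open>X\<close>, so they are computed under
  the mixture: both components share one variance and differ only in the offset of their mean from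
  \<open>m\<close>.\<close>

lemma kappa2_mixture:
  fixes X :: "'w \<Rightarrow> real^'q^'p"
  assumes \<alpha>: "0 < \<alpha>1" "\<alpha>1 < 1" "\<alpha>2 = 1 - \<alpha>1"
    and A: "sym_pos_def A" and B: "sym_pos_def B"
    and X: "X \<in> borel_measurable M"
    and distr: "distr M borel X = mixture \<alpha>1 (matrix_normal T1 A B) \<alpha>2 (matrix_normal T2 A B)"
    and T: "T2 - T1 = outer_product a b"
  shows "kappa2 M X (u, v) =
    (u \<bullet> (A *v u)) * (v \<bullet> (B *v v)) + \<alpha>1 * \<alpha>2 * (a \<bullet> u)\<^sup>2 * (b \<bullet> v)\<^sup>2"
proof -
  let ?P = "matrix_normal T1 A B" and ?Q = "matrix_normal T2 A B"
  have sets: "sets ?P = sets ?Q" by (simp add: matrix_normal_def)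
  have \<alpha>0: "0 \<le> \<alpha>1" "0 \<le> \<alpha>2" using \<alpha> by auto
  note mix = mixture_integral[OF sets \<alpha>0]
  note N = matrix_normal_bilinear_form[OF A B]
  have form: "integrable M (\<lambda>\<omega>. x \<bullet> (X \<omega> *v y))"
    "(\<integral>\<omega>. x \<bullet> (X \<omega> *v y) \<partial>M) = \<alpha>1 * (x \<bullet> (T1 *v y)) + \<alpha>2 * (x \<bullet> (T2 *v y))" for x y
  proof -
    show "integrable M (\<lambda>\<omega>. x \<bullet> (X \<omega> *v y))"
      unfolding integrable_distr_eq[OF X measurable_bilinear_form, symmetric] distr by (rule mix(1)) (rule N)+
    show "(\<integral>\<omega>. x \<bullet> (X \<omega> *v y) \<partial>M) = \<alpha>1 * (x \<bullet> (T1 *v y)) + \<alpha>2 * (x \<bullet> (T2 *v y))"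
      unfolding integral_distr[OF X measurable_bilinear_form, symmetric] distr
      by (subst mix(2)) (rule N, rule N, simp only: N(2))
  qed
  \<comment> \<open>Needed for the matrix-valued expectation inside \<open>kappa2\<close> to commute
    with the bilinear form. Axis vectors turn the form into single entries.\<close>
  have "integrable M X"
  proof (rule integrable_matrixI)
    fix i j
    show "integrable M (\<lambda>\<omega>. X \<omega> $ i $ j)"
      using form(1)[of "axis i 1" "axis j 1"]
      by (simp add: inner_axis' matrix_vector_mult_basis column_def)
  qed
  have "linear (\<lambda>Y. u \<bullet> (Y *v v))"
    by (rule linearI) (simp_all add: matrix_vector_mult_add_rdistrib inner_add_right scaleR_matrix_vector_assoc[symmetric])
  then have "bounded_linear (\<lambda>Y. u \<bullet> (Y *v v))" by (simp add: linear_conv_bounded_linear)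
  from integral_bounded_linear[OF this \<open>integrable M X\<close>]
  have mean: "u \<bullet> ((\<integral>\<omega>. X \<omega> \<partial>M) *v v) = \<alpha>1 * (u \<bullet> (T1 *v v)) + \<alpha>2 * (u \<bullet> (T2 *v v))"
    by (simp add: form)
  define m where "m = \<alpha>1 * (u \<bullet> (T1 *v v)) + \<alpha>2 * (u \<bullet> (T2 *v v))"
  have "outer_product a b *v v = (b \<bullet> v) *\<^sub>R a"
    by (simp add: vec_eq_iff outer_product_def matrix_vector_mult_def inner_vec_def sum_distrib_left mult_ac)
  moreover have "T2 = T1 + outer_product a b" using T by (simp add: algebra_simps)
  ultimately have T2: "u \<bullet> (T2 *v v) = u \<bullet> (T1 *v v) + (a \<bullet> u) * (b \<bullet> v)"
    by (simp add: matrix_vector_mult_add_rdistrib inner_add_right inner_commute mult_ac)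
  have m2: "(\<lambda>Y. (u \<bullet> (Y *v v) - m)\<^sup>2) \<in> borel_measurable borel" by measurable
  have "kappa2 M X (u, v) = (\<integral>\<omega>. (u \<bullet> (X \<omega> *v v) - m)\<^sup>2 \<partial>M)"
    by (simp add: kappa2_def matrix_vector_mult_diff_rdistrib inner_diff_right mean m_def)
  also have "\<dots> = \<alpha>1 * ((u \<bullet> (T1 *v v) - m)\<^sup>2 + (u \<bullet> (A *v u)) * (v \<bullet> (B *v v))) +
      \<alpha>2 * ((u \<bullet> (T2 *v v) - m)\<^sup>2 + (u \<bullet> (A *v u)) * (v \<bullet> (B *v v)))"
    unfolding integral_distr[OF X m2, symmetric] distr
    by (subst mix(2)) (rule N, rule N, simp only: N(4))
  \<comment> \<open>With \<open>D = (a \<bullet> u) * (b \<bullet> v)\<close> the two offsets are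
    \<open>- \<alpha>2 * D\<close> and \<open>\<alpha>1 * D\<close>; their weighted squares add up
    to \<open>\<alpha>1 * \<alpha>2\<close> times the square of \<open>D\<close>, as the weights sum
    to 1.\<close>
  also have "\<dots> = (u \<bullet> (A *v u)) * (v \<bullet> (B *v v)) + \<alpha>1 * \<alpha>2 * (a \<bullet> u)\<^sup>2 * (b \<bullet> v)\<^sup>2"
    unfolding m_def T2 \<alpha>(3) by (simp add: power2_eq_square algebra_simps)
  finally show ?thesis .
qed

section \<open>Maximizers on the product of spheres\<close>

text \<open>Optimality makes \<open>y\<close>, the inverse of \<open>A\<close> applied to
  \<open>a\<close>, an eigenvector of \<open>f\<close>. But \<open>A *v y = a\<close> makes
  \<open>f y\<close> a positive multiple of \<open>a\<close>, so \<open>a\<close> is a multiple of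
  \<open>y\<close>, and applying \<open>A\<close> gives the claim. Here \<open>c\<close> and
  \<open>d\<close> collect the contribution of the other, fixed argument.\<close>

lemma lda_direction_maximizer_eigenvector:
  assumes A: "sym_pos_def A" and c: "0 < c" "0 \<le> d"
    and unit: "norm (lda_direction A a) = 1"
    and max: "\<And>x. norm x = 1 \<Longrightarrow> c * (x \<bullet> (A *v x)) + d * (a \<bullet> x)\<^sup>2 \<le>
      c * (lda_direction A a \<bullet> (A *v lda_direction A a)) + d * (a \<bullet> lda_direction A a)\<^sup>2"
  shows "\<exists>k. eigenvector A a k"
proof -
  have tr: "transpose A = A" using A by (simp add: sym_pos_def_def)
  define y where "y = matrix_inv A *v a"
  define w where "w = lda_direction A a"
  have w: "w = (1 / norm y) *\<^sub>R y" by (simp add: w_def y_def lda_direction_def)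
  \<comment> \<open>For \<open>y = 0\<close> the direction would be the zero vector, division by
    zero being zero, against the unit norm.\<close>
  have y0: "y \<noteq> 0" using unit w by (auto simp: w_def[symmetric])
  have Ay: "A *v y = a" by (simp add: y_def sym_pos_def_matrix_inv[OF A])
  have a0: "a \<noteq> 0" using y0 by (auto simp: y_def)
  define f where "f x = c *\<^sub>R (A *v x) + (d * (a \<bullet> x)) *\<^sub>R a" for x
  have lin: "linear f"
    by (rule linearI) (simp_all add: f_def matrix_vector_right_distrib matrix_vector_mult_scaleR
        inner_add_right algebra_simps)
  have form: "x \<bullet> f x = c * (x \<bullet> (A *v x)) + d * (a \<bullet> x)\<^sup>2" for x
    by (simp add: f_def inner_add_right inner_commute power2_eq_square)
  have sym: "f x \<bullet> z = x \<bullet> f z" for x z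
    using sym_matrix_inner[OF tr, of x z] by (simp add: f_def inner_add_left inner_add_right inner_commute)
  define \<mu> where "\<mu> = w \<bullet> f w"
  have "f w = \<mu> *\<^sub>R w"
    unfolding \<mu>_def
    by (rule rayleigh_maximizer_eigenvector[OF subspace_UNIV lin _ sym])
      (use unit max in \<open>simp_all add: form w_def\<close>)
  then have "(1 / norm y) *\<^sub>R f y = (1 / norm y) *\<^sub>R (\<mu> *\<^sub>R y)"
    by (simp add: w linear_cmul[OF lin])
  then have fy: "f y = \<mu> *\<^sub>R y" using y0 by (simp del: scaleR_scaleR)
  define s where "s = c + d * (y \<bullet> (A *v y))"
  have "0 < y \<bullet> (A *v y)" using A y0 by (simp add: sym_pos_def_def)
  then have s: "0 < s" using c by (simp add: s_def add_pos_nonneg)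
  have "s *\<^sub>R a = \<mu> *\<^sub>R y"
    using fy by (simp add: f_def s_def Ay inner_commute scaleR_add_left)
  then have "A *v (s *\<^sub>R a) = \<mu> *\<^sub>R a" by (simp add: matrix_vector_mult_scaleR Ay)
  then have "(1 / s) *\<^sub>R (s *\<^sub>R (A *v a)) = (1 / s) *\<^sub>R (\<mu> *\<^sub>R a)" by (simp add: matrix_vector_mult_scaleR)
  then have "A *v a = (\<mu> / s) *\<^sub>R a" using s by simp
  then show ?thesis using a0 by (auto simp: eigenvector_def)
qed

section \<open>Maximizers when both vectors are eigenvectors\<close>

text \<open>Split \<open>u\<close> into its component along \<open>e\<close> and a remainder
  \<open>w\<close> orthogonal to \<open>e\<close>. The cross term vanishes because \<open>e\<close>
  is an eigenvector, and the Rayleigh bound controls the part from \<open>w\<close>.\<close>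

lemma quadratic_form_eigenvector_split:
  assumes tr: "transpose A = A" and e: "norm e = 1" "A *v e = k *\<^sub>R e" and u: "norm u = 1"
  shows "(e \<bullet> u)\<^sup>2 \<le> 1"
    and "u \<bullet> (A *v u) \<le> (e \<bullet> u)\<^sup>2 * k + (1 - (e \<bullet> u)\<^sup>2) * largest_eigenvalue A"
    and "(e \<bullet> u)\<^sup>2 = 1 \<Longrightarrow> u = e \<or> u = - e"
proof -
  define t where "t = e \<bullet> u"
  define w where "w = u - t *\<^sub>R e"
  have ee: "e \<bullet> e = 1" "u \<bullet> u = 1" using e u by (simp_all add: norm_eq_1)
  have ew: "e \<bullet> w = 0" by (simp add: w_def t_def inner_diff_right ee)
  have u_eq: "u = t *\<^sub>R e + w" by (simp add: w_def)
  have nw: "(norm w)\<^sup>2 = 1 - t\<^sup>2"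
    unfolding power2_norm_eq_inner w_def
    by (simp add: inner_diff_left inner_diff_right ee t_def inner_commute power2_eq_square)
  show "(e \<bullet> u)\<^sup>2 \<le> 1" using nw zero_le_power2[of "norm w"] by (simp add: t_def)
  have "e \<bullet> (A *v w) = 0" using sym_matrix_inner[OF tr, of e w] by (simp add: e ew)
  then have "u \<bullet> (A *v u) = t\<^sup>2 * k + w \<bullet> (A *v w)"
    unfolding u_eq using ew
    by (simp add: matrix_vector_right_distrib matrix_vector_mult_scaleR e inner_add_left inner_add_right
        ee inner_commute power2_eq_square)
  then show "u \<bullet> (A *v u) \<le> (e \<bullet> u)\<^sup>2 * k + (1 - (e \<bullet> u)\<^sup>2) * largest_eigenvalue A"
    using largest_eigenvalue_sym(2)[OF tr, of w] by (simp add: nw t_def mult.commute)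
  assume "(e \<bullet> u)\<^sup>2 = 1"
  then have "(norm w)\<^sup>2 = 0" "t = 1 \<or> t = - 1" unfolding nw by (simp_all add: t_def power2_eq_1_iff)
  then show "u = e \<or> u = - e" using u_eq by auto
qed

text \<open>\<open>F\<close> is the value at the LDA pairs. If \<open>F\<close> exceeds the product
  of the largest eigenvalues, any other pair loses a positive multiple of the excess; if not, a pair
  of top eigenvectors does at least as well.\<close>

lemma unique_maximizers_eigenvectors_iff:
  fixes A :: "real^'p^'p" and B :: "real^'q^'q"
  assumes K: "\<And>u v. K (u, v) = (u \<bullet> (A *v u)) * (v \<bullet> (B *v v)) + c * (a \<bullet> u)\<^sup>2 * (b \<bullet> v)\<^sup>2"
    and c: "0 < c" and A: "sym_pos_def A" and B: "sym_pos_def B"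
    and a: "eigenvector A a sa" and b: "eigenvector B b lb"
  shows "unique_maximizers_up_to_sign K (lda_direction A a) (lda_direction B b) \<longleftrightarrow>
    sa * lb + c * (norm a)\<^sup>2 * (norm b)\<^sup>2 > largest_eigenvalue A * largest_eigenvalue B"
proof -
  define e where "e = (1 / norm a) *\<^sub>R a"
  define h where "h = (1 / norm b) *\<^sub>R b"
  define \<sigma> where "\<sigma> = largest_eigenvalue A"
  define \<tau> where "\<tau> = largest_eigenvalue B"
  define k where "k = c * (norm a)\<^sup>2 * (norm b)\<^sup>2"
  define F where "F = sa * lb + k"
  have trA: "transpose A = A" and trB: "transpose B = B" using A B by (auto simp: sym_pos_def_def)
  have a0: "a \<noteq> 0" "A *v a = sa *\<^sub>R a" and b0: "b \<noteq> 0" "B *v b = lb *\<^sub>R b"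
    using a b by (auto simp: eigenvector_def)
  have e: "norm e = 1" "A *v e = sa *\<^sub>R e" and h: "norm h = 1" "B *v h = lb *\<^sub>R h"
    using a0 b0 by (simp_all add: e_def h_def matrix_vector_mult_scaleR)
  have k0: "0 < k" using c a0 b0 by (simp add: k_def)
  have K': "K (u, v) = (u \<bullet> (A *v u)) * (v \<bullet> (B *v v)) + k * ((e \<bullet> u)\<^sup>2 * (h \<bullet> v)\<^sup>2)" for u v
    using a0 b0 by (simp add: K k_def e_def h_def power_divide)
  have pos: "0 < sa" "0 < lb" "0 < \<sigma>" "0 < \<tau>"
    using eigenvalue_sym_pos_def[OF A] eigenvalue_sym_pos_def[OF B] a b
      largest_eigenvalue_sym(1)[OF trA] largest_eigenvalue_sym(1)[OF trB]
    by (auto simp: eigenvalue_def \<sigma>_def \<tau>_def)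
  have le: "sa \<le> \<sigma>" "lb \<le> \<tau>"
    using largest_eigenvalue_sym(2)[OF trA, of e] largest_eigenvalue_sym(2)[OF trB, of h] e h
    by (simp_all add: \<sigma>_def \<tau>_def norm_eq_1)
  define L where "L = {(s *\<^sub>R e, t *\<^sub>R h) | s t. s \<in> {-1, 1} \<and> t \<in> {-1, 1::real}}"
  have L: "(u, v) \<in> L \<longleftrightarrow> (u = e \<or> u = - e) \<and> (v = h \<or> v = - h)" for u v
  proof -
    \<comment> \<open>Bounded quantifiers over the signs let \<open>auto\<close> enumerate the four
      cases.\<close>
    have "L = {p. \<exists>s\<in>{-1, 1}. \<exists>t\<in>{-1, 1}. p = (s *\<^sub>R e, t *\<^sub>R h)}" unfolding L_def by blast
    then show ?thesis by auto
  qed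
  have um: "unique_maximizers_up_to_sign K (lda_direction A a) (lda_direction B b) \<longleftrightarrow> maximizers K U0 = L"
    by (simp add: unique_maximizers_up_to_sign_def lda_direction_eigenvector[OF A a]
        lda_direction_eigenvector[OF B b] L_def e_def h_def)
  have U0: "(u, v) \<in> U0 \<longleftrightarrow> norm u = 1 \<and> norm v = 1" for u :: "real^'p" and v :: "real^'q"
    by (auto simp: U0_def)
  have quad: "x \<bullet> (C *v x) = (-x) \<bullet> (C *v (-x))" for x :: "real^'n" and C :: "real^'n^'n"
    using matrix_vector_mult_scaleR[of C "-1" x] by simp
  have KL: "K (u, v) = F" if "(u, v) \<in> L" for u v
  proof -
    have "u \<bullet> (A *v u) = sa" "v \<bullet> (B *v v) = lb" "(e \<bullet> u)\<^sup>2 = 1" "(h \<bullet> v)\<^sup>2 = 1"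
      using that e h quad[of e A] quad[of h B] by (auto simp: L norm_eq_1)
    then show ?thesis by (simp add: K' F_def)
  qed
  show ?thesis
    unfolding um k_def[symmetric] F_def[symmetric] \<sigma>_def[symmetric] \<tau>_def[symmetric]
  proof
    assume gt: "\<sigma> * \<tau> < F"
    \<comment> \<open>In terms of the squared cosines \<open>x\<close> and \<open>y\<close>, the
      right side is the convex combination of \<open>F\<close> and \<open>\<sigma> * \<tau>\<close>
      with weight \<open>x * y\<close> on \<open>F\<close>.\<close>
    have bound: "K (u, v) \<le> F - (1 - (e \<bullet> u)\<^sup>2 * (h \<bullet> v)\<^sup>2) * (F - \<sigma> * \<tau>)"
      if "norm u = 1" "norm v = 1" for u v
    proof -
      define x y where "x = (e \<bullet> u)\<^sup>2" and "y = (h \<bullet> v)\<^sup>2"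
      have x: "0 \<le> x" "x \<le> 1" "u \<bullet> (A *v u) \<le> x * sa + (1 - x) * \<sigma>"
        using quadratic_form_eigenvector_split[OF trA e that(1)] by (auto simp: x_def \<sigma>_def)
      have y: "0 \<le> y" "y \<le> 1" "v \<bullet> (B *v v) \<le> y * lb + (1 - y) * \<tau>"
        using quadratic_form_eigenvector_split[OF trB h that(2)] by (auto simp: y_def \<tau>_def)
      have "0 \<le> v \<bullet> (B *v v)" using B by (cases "v = 0") (auto simp: sym_pos_def_def less_imp_le)
      then have "(u \<bullet> (A *v u)) * (v \<bullet> (B *v v)) \<le> (x * sa + (1 - x) * \<sigma>) * (y * lb + (1 - y) * \<tau>)"
        using x y pos by (intro mult_mono) auto
      also have "\<dots> = x * y * (sa * lb) + x * (1 - y) * (sa * \<tau>) + (1 - x) * y * (\<sigma> * lb) +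
          (1 - x) * (1 - y) * (\<sigma> * \<tau>)"
        by (simp add: algebra_simps)
      \<comment> \<open>The two mixed vertex values \<open>sa * \<tau>\<close> and
        \<open>\<sigma> * lb\<close> are raised to \<open>\<sigma> * \<tau>\<close>, so only two
        values remain.\<close>
      also have "\<dots> \<le> x * y * (sa * lb) + x * (1 - y) * (\<sigma> * \<tau>) + (1 - x) * y * (\<sigma> * \<tau>) +
          (1 - x) * (1 - y) * (\<sigma> * \<tau>)"
        using x y pos le by (intro add_mono mult_left_mono mult_right_mono) auto
      also have "\<dots> = x * y * (sa * lb) + (1 - x * y) * (\<sigma> * \<tau>)" by (simp add: algebra_simps)
      finally show ?thesis by (simp add: K' x_def[symmetric] y_def[symmetric] F_def algebra_simps)
    qed
    have prod1: "(e \<bullet> u)\<^sup>2 * (h \<bullet> v)\<^sup>2 \<le> 1" if "norm u = 1" "norm v = 1" for u v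
      using quadratic_form_eigenvector_split(1)[OF trA e that(1)]
        quadratic_form_eigenvector_split(1)[OF trB h that(2)]
      by (simp add: mult_le_one)
    have KF: "K (u, v) \<le> F" if "norm u = 1" "norm v = 1" for u v
    proof -
      have "0 \<le> (1 - (e \<bullet> u)\<^sup>2 * (h \<bullet> v)\<^sup>2) * (F - \<sigma> * \<tau>)"
        using prod1[OF that] gt by (intro mult_nonneg_nonneg) auto
      then show ?thesis using bound[OF that] by linarith
    qed
    show "maximizers K U0 = L"
    proof (intro set_eqI iffI)
      fix p assume p: "p \<in> L"
      obtain u v where uv: "p = (u, v)" by (cases p)
      have "norm u = 1" "norm v = 1" using p e h by (auto simp: uv L)
      then show "p \<in> maximizers K U0"
        using KF KL p by (auto simp: maximizers_def uv U0)
    next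
      fix p assume p: "p \<in> maximizers K U0"
      obtain u v where uv: "p = (u, v)" by (cases p)
      have n: "norm u = 1" "norm v = 1" using p by (auto simp: maximizers_def uv U0)
      have "K (e, h) \<le> K (u, v)" using p e h by (auto simp: maximizers_def uv U0)
      then have "F \<le> K (u, v)" using KL[of e h] by (simp add: L)
      with bound[OF n] have "(1 - (e \<bullet> u)\<^sup>2 * (h \<bullet> v)\<^sup>2) * (F - \<sigma> * \<tau>) \<le> 0" by linarith
      then have "1 \<le> (e \<bullet> u)\<^sup>2 * (h \<bullet> v)\<^sup>2" using gt by (simp add: mult_le_0_iff)
      moreover have xy: "(e \<bullet> u)\<^sup>2 \<le> 1" "(h \<bullet> v)\<^sup>2 \<le> 1"
        using quadratic_form_eigenvector_split(1)[OF trA e n(1)]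
          quadratic_form_eigenvector_split(1)[OF trB h n(2)] by auto
      \<comment> \<open>A product of two numbers in the unit interval lies below each factor, so a
        product of at least 1 forces both to be 1.\<close>
      moreover have "(e \<bullet> u)\<^sup>2 * (h \<bullet> v)\<^sup>2 \<le> (e \<bullet> u)\<^sup>2" "(e \<bullet> u)\<^sup>2 * (h \<bullet> v)\<^sup>2 \<le> (h \<bullet> v)\<^sup>2"
        by (rule mult_left_le[OF xy(2)], simp) (rule mult_left_le_one_le[OF _ _ xy(1)], simp_all)
      ultimately have "(e \<bullet> u)\<^sup>2 = 1" "(h \<bullet> v)\<^sup>2 = 1" by linarith+
      then show "p \<in> L"
        using quadratic_form_eigenvector_split(3)[OF trA e n(1)]
          quadratic_form_eigenvector_split(3)[OF trB h n(2)] by (simp add: uv L)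
    qed
  next
    assume eq: "maximizers K U0 = L"
    show "\<sigma> * \<tau> < F"
    proof (rule ccontr)
      assume ng: "\<not> \<sigma> * \<tau> < F"
      obtain u where u: "norm u = 1" "A *v u = \<sigma> *\<^sub>R u"
        using eigenvalue_unit_eigenvector[OF largest_eigenvalue_sym(1)[OF trA]] unfolding \<sigma>_def .
      obtain v where v: "norm v = 1" "B *v v = \<tau> *\<^sub>R v"
        using eigenvalue_unit_eigenvector[OF largest_eigenvalue_sym(1)[OF trB]] unfolding \<tau>_def .
      have Kuv: "K (u, v) = \<sigma> * \<tau> + k * ((e \<bullet> u)\<^sup>2 * (h \<bullet> v)\<^sup>2)"
        using u v by (simp add: K' norm_eq_1)
      have "0 \<le> k * ((e \<bullet> u)\<^sup>2 * (h \<bullet> v)\<^sup>2)" using k0 by simp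
      with Kuv ng have FK: "F \<le> K (u, v)" by linarith
      have eh: "(e, h) \<in> maximizers K U0" using eq by (simp add: L)
      have "K p \<le> K (u, v)" if "p \<in> U0" for p
      proof -
        have "K p \<le> K (e, h)" using eh that by (simp add: maximizers_def)
        then show ?thesis using KL[of e h] FK by (simp add: L)
      qed
      \<comment> \<open>The top pair is a maximizer, hence an LDA pair up to signs. Its squared
        cosines are then 1, so its value exceeds \<open>\<sigma> * \<tau>\<close> by the full
        \<open>k\<close>.\<close>
      then have uvL: "(u, v) \<in> L" using u v eq by (auto simp: maximizers_def U0)
      then have "(e \<bullet> u)\<^sup>2 = 1" "(h \<bullet> v)\<^sup>2 = 1" using e h by (auto simp: L norm_eq_1)
      then have "F = \<sigma> * \<tau> + k" using Kuv KL[OF uvL] by simp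
      then show False using ng k0 by simp
    qed
  qed
qed

theorem theorem4:
  fixes M :: "'w measure"
    and X :: "'w \<Rightarrow> real^'q^'p"
    and \<alpha>1 \<alpha>2 :: real
    and A :: "real^'p^'p" and B :: "real^'q^'q"
    and T1 T2 :: "real^'q^'p"
    and a uLDA :: "real^'p" and b vLDA :: "real^'q"
  assumes "0 < \<alpha>1" "\<alpha>1 < 1" "\<alpha>2 = 1 - \<alpha>1"
    and "sym_pos_def A" "sym_pos_def B"
    and "T1 \<noteq> T2"
    and "prob_space M" "X \<in> borel_measurable M"
    and "distr M borel X = mixture \<alpha>1 (matrix_normal T1 A B) \<alpha>2 (matrix_normal T2 A B)"
    and "T2 - T1 = outer_product a b"
    and "uLDA = lda_direction A a" "vLDA = lda_direction B b"
  shows "(unique_maximizers_up_to_sign (kappa2 M X) uLDA vLDA \<longrightarrow>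
            (\<exists>k. eigenvector A a k) \<and> (\<exists>k. eigenvector B b k)) \<and>
         (\<forall>sa lb. eigenvector A a sa \<and> simple_eigenvalue A sa \<and>
                   eigenvector B b lb \<and> simple_eigenvalue B lb \<longrightarrow>
            (unique_maximizers_up_to_sign (kappa2 M X) uLDA vLDA \<longleftrightarrow>
             sa * lb + \<alpha>1 * \<alpha>2 * (norm a)\<^sup>2 * (norm b)\<^sup>2
               > largest_eigenvalue A * largest_eigenvalue B))"
proof -
  define c where "c = \<alpha>1 * \<alpha>2"
  have c: "0 < c" using assms(1-3) by (simp add: c_def)
  have K: "kappa2 M X (u, v) = (u \<bullet> (A *v u)) * (v \<bullet> (B *v v)) + c * (a \<bullet> u)\<^sup>2 * (b \<bullet> v)\<^sup>2" for u v
    unfolding c_def by (rule kappa2_mixture) fact+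
  have A: "0 < x \<bullet> (A *v x)" if "norm x = 1" for x
    using assms(4) that by (metis norm_zero sym_pos_def_def zero_neq_one)
  have B: "0 < x \<bullet> (B *v x)" if "norm x = 1" for x
    using assms(5) that by (metis norm_zero sym_pos_def_def zero_neq_one)
  have eigen: "(\<exists>k. eigenvector A a k) \<and> (\<exists>k. eigenvector B b k)"
    if "unique_maximizers_up_to_sign (kappa2 M X) uLDA vLDA"
  proof -
    \<comment> \<open>Signs \<open>s = t = 1\<close>. Membership in \<open>U0\<close> then yields
      the unit norms, which exclude degenerate \<open>a\<close> or \<open>b\<close>.\<close>
    have "(uLDA, vLDA) \<in> maximizers (kappa2 M X) U0"
      using that unfolding unique_maximizers_up_to_sign_def
      by (auto intro!: exI[of _ 1])
    then have n: "norm uLDA = 1" "norm vLDA = 1"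
      and max: "\<And>u v. norm u = 1 \<Longrightarrow> norm v = 1 \<Longrightarrow> kappa2 M X (u, v) \<le> kappa2 M X (uLDA, vLDA)"
      by (auto simp: maximizers_def U0_def)
    \<comment> \<open>With \<open>vLDA\<close> held fixed, its positive quadratic form under
      \<open>B\<close> plays the role of the coefficient \<open>c\<close> of the lemma.\<close>
    have "\<exists>k. eigenvector A a k"
    proof (rule lda_direction_maximizer_eigenvector[OF assms(4) B[OF n(2)]])
      show "0 \<le> c * (b \<bullet> vLDA)\<^sup>2" using c by simp
      show "norm (lda_direction A a) = 1" using n by (simp add: assms)
      show "vLDA \<bullet> (B *v vLDA) * (x \<bullet> (A *v x)) + c * (b \<bullet> vLDA)\<^sup>2 * (a \<bullet> x)\<^sup>2 \<le>
        vLDA \<bullet> (B *v vLDA) * (lda_direction A a \<bullet> (A *v lda_direction A a)) +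
        c * (b \<bullet> vLDA)\<^sup>2 * (a \<bullet> lda_direction A a)\<^sup>2" if "norm x = 1" for x
        using max[OF that n(2)] unfolding K assms(11)[symmetric] by (simp add: mult_ac)
    qed
    moreover have "\<exists>k. eigenvector B b k"
    proof (rule lda_direction_maximizer_eigenvector[OF assms(5) A[OF n(1)]])
      show "0 \<le> c * (a \<bullet> uLDA)\<^sup>2" using c by simp
      show "norm (lda_direction B b) = 1" using n by (simp add: assms)
      show "uLDA \<bullet> (A *v uLDA) * (x \<bullet> (B *v x)) + c * (a \<bullet> uLDA)\<^sup>2 * (b \<bullet> x)\<^sup>2 \<le>
        uLDA \<bullet> (A *v uLDA) * (lda_direction B b \<bullet> (B *v lda_direction B b)) +
        c * (a \<bullet> uLDA)\<^sup>2 * (b \<bullet> lda_direction B b)\<^sup>2" if "norm x = 1" for x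
        using max[OF n(1) that] unfolding K assms(12)[symmetric] by (simp add: mult_ac)
    qed
    ultimately show ?thesis ..
  qed
  have iff: "unique_maximizers_up_to_sign (kappa2 M X) uLDA vLDA \<longleftrightarrow>
      sa * lb + \<alpha>1 * \<alpha>2 * (norm a)\<^sup>2 * (norm b)\<^sup>2 > largest_eigenvalue A * largest_eigenvalue B"
    if "eigenvector A a sa" "eigenvector B b lb" for sa lb
    unfolding assms(11,12) c_def[symmetric]
    by (rule unique_maximizers_eigenvectors_iff[OF K c assms(4,5) that])
  show ?thesis using eigen iff by blast
qed

end
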